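(* Let $(X,\mathcal{B},\mu)$ be a Lebesgue probability space and let $T:X\to X$ be an invertible measure preserving strong mixing transformation. Then $T$ has strictly over-recurrent sets of arbitrarily small measure; that is, for every $\delta>0$ there exists a measurable set $A$ with $0<\mu(A)<1$ and $\mu(A)<\delta$ such that $$\mu(T^nA\cap A)>\mu(A)^2\quad\text{for all } n\in\mathbb{Z}.$$
   Context: A Lebesgue probability space is a (non-atomic) standard probability space, i.e. isomorphic mod null sets to $[0,1]$ with Lebesgue measure. $T$ is invertible measure preserving if it is a bijection (mod null sets), bi-measurable, and $\mu(TA)=\mu(A)$ for all measurable $A$. $T$ is strong mixing if $\lim_{n\to\infty}\mu(T^nA\cap B)=\mu(A)\mu(B)$ for all measurable $A,B$. A measurable set $A$ with $0<\mu(A)<1$ is strictly over-recurrent for $T$ if $\mu(T^nA\cap A)>\mu(A)^2$ for all $n\in\mathbb{Z}$. *)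

theory Defs
  imports "HOL-Probability.Probability"
begin

definition full_measure_set :: "'a measure \<Rightarrow> 'a set \<Rightarrow> bool" where
  "full_measure_set M X \<longleftrightarrow> X \<in> sets M \<and> emeasure M (space M - X) = 0"

definition mod_null_isomorphism ::
  "'a measure \<Rightarrow> 'a set \<Rightarrow> 'b measure \<Rightarrow> 'b set \<Rightarrow> ('a \<Rightarrow> 'b) \<Rightarrow> bool" where
  "mod_null_isomorphism M X N Y f \<longleftrightarrow>
     full_measure_set M X \<and> full_measure_set N Y \<and>
     bij_betw f X Y \<and>
     f \<in> measurable (restrict_space M X) (restrict_space N Y) \<and>
     inv_into X f \<in> measurable (restrict_space N Y) (restrict_space M X) \<and>
     (\<forall>A\<in>sets M. A \<subseteq> X \<longrightarrow> emeasure N (f ` A) = emeasure M A)"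

text \<open>The completion is taken so that both conventions for the sigma-algebra of a standard
  probability space, Borel and complete, are covered.\<close>

definition lebesgue_probability_space :: "'a measure \<Rightarrow> bool" where
  "lebesgue_probability_space M \<longleftrightarrow> prob_space M \<and>
     (\<exists>X Y f. mod_null_isomorphism (completion M) X
                (lebesgue_on {0..1::real}) Y f)"

text \<open>A map that is bijective modulo null sets is given together with a measurable set \<open>X\<close> of
  full measure which it maps bijectively onto itself. If \<open>T\<close> is merely a measure preserving
  isomorphism between two sets of full measure, the points whose whole two-sided orbit is
  defined form such a set \<open>X\<close>. All images under iterates of \<open>T\<close> are taken inside \<open>X\<close>; another
  choice of \<open>X\<close> changes them only by null sets, and for a genuine bijection \<open>X\<close> may be the
  whole space.\<close>

definition invertible_measure_preserving ::
  "'a measure \<Rightarrow> 'a set \<Rightarrow> ('a \<Rightarrow> 'a) \<Rightarrow> bool" where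
  "invertible_measure_preserving M X T \<longleftrightarrow>
     T \<in> space M \<rightarrow> space M \<and> mod_null_isomorphism M X M X T"

definition int_iterate :: "'a set \<Rightarrow> ('a \<Rightarrow> 'a) \<Rightarrow> int \<Rightarrow> 'a \<Rightarrow> 'a" where
  "int_iterate X T n =
     (if n \<ge> 0 then T ^^ nat n else inv_into X T ^^ nat (- n))"

definition iterate_image :: "'a set \<Rightarrow> ('a \<Rightarrow> 'a) \<Rightarrow> int \<Rightarrow> 'a set \<Rightarrow> 'a set" where
  "iterate_image X T n A = int_iterate X T n ` (A \<inter> X)"

definition strong_mixing :: "'a measure \<Rightarrow> 'a set \<Rightarrow> ('a \<Rightarrow> 'a) \<Rightarrow> bool" where
  "strong_mixing M X T \<longleftrightarrow>
     (\<forall>A\<in>sets M. \<forall>B\<in>sets M.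
        (\<lambda>n. measure M (iterate_image X T (int n) A \<inter> B))
          \<longlonglongrightarrow> measure M A * measure M B)"

definition strictly_over_recurrent ::
  "'a measure \<Rightarrow> 'a set \<Rightarrow> ('a \<Rightarrow> 'a) \<Rightarrow> 'a set \<Rightarrow> bool" where
  "strictly_over_recurrent M X T A \<longleftrightarrow>
     A \<in> sets M \<and> 0 < measure M A \<and> measure M A < 1 \<and>
     (\<forall>n::int. measure M (iterate_image X T n A \<inter> A) > (measure M A)\<^sup>2)"

end

theory Submission
  imports Defs
begin

text \<open>The set is built as an increasing union \<open>A = (\<Union>k. F k)\<close>, where step \<open>k\<close> adds to the
  set obtained so far a new set \<open>C\<close> of measure about \<open>d\<^sub>k = c / 2 ^ k\<close>. Call
  \<open>\<mu> (T\<^sup>n A \<inter> A) - \<mu>(A)\<^sup>2\<close> the excess of \<open>A\<close> at time \<open>n\<close>; it has to become positive at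
  every \<open>n\<close>.

  The set \<open>C\<close> is almost invariant under all powers up to a large bound \<open>L\<close>. For \<open>n \<le> L\<close>, almost
  all of \<open>C\<close> returns to \<open>C\<close>, so the first term of the excess gains almost \<open>d\<^sub>k\<close>, whereas
  \<open>\<mu>(A)\<^sup>2\<close> grows only by about \<open>2 \<mu>(A) d\<^sub>k\<close>. As the total measure stays below
  \<open>1 / 16\<close> and \<open>C\<close> hardly meets the old set, the excess rises by at least \<open>d\<^sub>k / 2\<close> there. For \<open>n > L\<close> nothing is known
  about the returns of \<open>C\<close>, but they are not negative, so the excess drops by at most \<open>d\<^sub>k / 4\<close>.
  Mixing makes the excess of the old set tend to \<open>0\<close>, and \<open>L\<close> is chosen so large
  that a drop can only start from an excess of at least \<open>- d\<^sub>k / 8\<close> (\<open>enlarge\<close>). Thus the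
  excess never falls below \<open>- (3/8) d\<^sub>k\<close>. At a fixed time all but finitely many steps are gains,
  and after step \<open>k\<close> these add up to \<open>\<Sum>j>k. d\<^sub>j / 2 = d\<^sub>k / 2\<close>, which exceeds the possible
  debt: in the limit the excess is positive (\<open>over_recurrent_set\<close>).

  An almost invariant set of prescribed measure is a union \<open>\<Union>j<R. S\<^sup>-\<^sup>j E\<close> of
  preimages of a set \<open>E\<close> of tiny measure: mixing implies that these unions sweep out the whole space,
  in increments of at most \<open>\<mu>(E)\<close> (\<open>sweep_out\<close>, \<open>almost_invariant_set\<close>). A Lebesgue space
  supplies such sets \<open>E\<close>. All this is done with preimages under the inverse \<open>S\<close> of \<open>T\<close>, which are the
  images under \<open>T\<close>; negative times follow from \<open>\<mu> (T\<^sup>-\<^sup>n A \<inter> A) = \<mu> (A \<inter> T\<^sup>n A)\<close>.\<close>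

section \<open>Mixing endomorphisms\<close>

lemma measurable_funpow: "f \<in> measurable M M \<Longrightarrow> f ^^ n \<in> measurable M M"
  by (induction n) (auto intro: measurable_comp)

text \<open>Preimages rather than images carry the construction: they commute with all set operations
  and are measurable.\<close>

locale mixing_endomorphism = prob_space +
  fixes S :: "'a \<Rightarrow> 'a"
  assumes S_measurable [measurable]: "S \<in> measurable M M"
    and S_preserving: "A \<in> events \<Longrightarrow> prob (S -` A \<inter> space M) = prob A"
    and S_mixing: "\<lbrakk>A \<in> events; B \<in> events\<rbrakk> \<Longrightarrow>
      (\<lambda>n. prob ((S ^^ n) -` A \<inter> space M \<inter> B)) \<longlonglongrightarrow> prob A * prob B"
begin

definition preimage :: "nat \<Rightarrow> 'a set \<Rightarrow> 'a set" where
  "preimage n A = (S ^^ n) -` A \<inter> space M"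

definition excess :: "'a set \<Rightarrow> nat \<Rightarrow> real" where
  "excess A n = prob (preimage n A \<inter> A) - (prob A)\<^sup>2"

lemma funpow_measurable [measurable]: "S ^^ n \<in> measurable M M"
  by (rule measurable_funpow) (rule S_measurable)

lemma preimage_sets [simp, intro]: "A \<in> events \<Longrightarrow> preimage n A \<in> events"
  unfolding preimage_def by measurable

lemma preimage_preimage: "preimage n (preimage m A) = preimage (m + n) A"
  using measurable_space[OF funpow_measurable]
  by (auto simp: preimage_def funpow_add)

lemma preimage_Int: "preimage n (A \<inter> B) = preimage n A \<inter> preimage n B"
  by (auto simp: preimage_def)

lemma preimage_mono: "A \<subseteq> B \<Longrightarrow> preimage n A \<subseteq> preimage n B"
  by (auto simp: preimage_def)

lemma prob_preimage [simp]: "A \<in> events \<Longrightarrow> prob (preimage n A) = prob A"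
proof (induction n arbitrary: A)
  case 0
  then show ?case
    using sets.sets_into_space by (auto simp: preimage_def Int_absorb2)
next
  case (Suc n)
  have "preimage (Suc n) A = preimage n (preimage 1 A)"
    by (simp add: preimage_preimage)
  moreover have "prob (preimage 1 A) = prob A"
    using S_preserving[OF Suc.prems] by (simp add: preimage_def)
  ultimately show ?case
    using Suc by (metis preimage_sets)
qed

lemma preimage_mixing:
  "\<lbrakk>A \<in> events; B \<in> events\<rbrakk> \<Longrightarrow> (\<lambda>n. prob (preimage n A \<inter> B)) \<longlonglongrightarrow> prob A * prob B"
  using S_mixing by (simp add: preimage_def)

lemma excess_tendsto_0:
  assumes "A \<in> events"
  shows "excess A \<longlonglongrightarrow> 0"
proof -
  have "(\<lambda>n. prob (preimage n A \<inter> A) - (prob A)\<^sup>2) \<longlonglongrightarrow> prob A * prob A - (prob A)\<^sup>2"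
    by (intro tendsto_intros preimage_mixing assms)
  then show ?thesis
    by (simp add: excess_def [abs_def] power2_eq_square)
qed

text \<open>A set that misses every preimage of \<open>E\<close> has correlation \<open>0\<close> with \<open>E\<close> at all times, but
  mixing makes this correlation tend to the product of the measures.\<close>

lemma sweep_out:
  assumes "E \<in> events" "prob E > 0"
  shows "(\<lambda>R. prob (\<Union>j<R. preimage j E)) \<longlonglongrightarrow> 1"
proof -
  define W where "W = (\<Union>j. preimage j E)"
  have W: "W \<in> events"
    using assms by (auto simp: W_def)
  have "prob (preimage n E \<inter> (space M - W)) = 0" for n
  proof -
    have "preimage n E \<inter> (space M - W) = {}"
      by (auto simp: W_def)
    then show ?thesis
      by simp
  qed
  moreover have "(\<lambda>n. prob (preimage n E \<inter> (space M - W))) \<longlonglongrightarrow> prob E * prob (space M - W)"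
    using assms W by (intro preimage_mixing) auto
  ultimately have "prob E * prob (space M - W) = 0"
    by (simp add: LIMSEQ_const_iff)
  then have "prob W = 1"
    using assms W by (simp add: prob_compl)
  moreover have "(\<lambda>R. prob (\<Union>j<R. preimage j E)) \<longlonglongrightarrow> prob (\<Union>R. \<Union>j<R. preimage j E)"
    using assms by (intro finite_Lim_measure_incseq) (auto simp: incseq_def intro: order_less_le_trans)
  moreover have "(\<Union>R. \<Union>j<R. preimage j E) = W"
    by (auto simp: W_def)
  ultimately show ?thesis
    by simp
qed

text \<open>Applying \<open>S\<^sup>-\<^sup>n\<close> to a long union \<open>\<Union>j<R. S\<^sup>-\<^sup>j E\<close> only adds the \<open>n\<close> preimages with
  index from \<open>R\<close> on, at a cost of \<open>n * prob E\<close>. So \<open>E\<close> is chosen small in terms of \<open>L\<close> first, and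
  then \<open>R\<close> is the first index at which the union reaches the measure \<open>d\<close>; the last preimage added
  overshoots \<open>d\<close> by at most \<open>prob E\<close>.\<close>

lemma almost_invariant_set:
  assumes small: "\<And>\<epsilon>. \<epsilon> > 0 \<Longrightarrow> \<exists>E\<in>events. 0 < prob E \<and> prob E < \<epsilon>"
    and d: "0 < d" "d < 1" and \<eta>: "\<eta> > 0"
  obtains D where "D \<in> events" "d \<le> prob D" "prob D \<le> d + \<eta>"
    "\<And>n. n \<le> L \<Longrightarrow> prob (preimage n D \<inter> D) \<ge> prob D - \<eta>"
proof -
  obtain E where E: "E \<in> events" "0 < prob E" "prob E < \<eta> / (real L + 1)"
    using small[of "\<eta> / (real L + 1)"] \<eta> by auto
  define U where "U R = (\<Union>j<R. preimage j E)" for R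
  have U: "U R \<in> events" for R
    using E by (auto simp: U_def)
  have "eventually (\<lambda>R. prob (U R) > d) sequentially"
    using order_tendstoD(1)[OF sweep_out[OF E(1,2)] d(2)] by (simp add: U_def)
  then have ex: "\<exists>R. prob (U R) \<ge> d"
    by (auto simp: eventually_sequentially intro: less_imp_le)
  define R where "R = (LEAST R. prob (U R) \<ge> d)"
  have R: "prob (U R) \<ge> d"
    unfolding R_def using ex by (rule LeastI_ex)
  have bound: "prob E * (real L + 1) < \<eta>"
    using E(3) by (simp add: field_simps)
  have "R \<noteq> 0"
    using R d by (intro notI) (simp add: U_def)
  then obtain R' where R': "R = Suc R'"
    by (cases R) auto
  have "\<not> prob (U R') \<ge> d"
    using not_less_Least[of R' "\<lambda>R. prob (U R) \<ge> d"] R' by (simp add: R_def)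
  moreover have "prob (U R) \<le> prob (U R') + prob (preimage R' E)"
    using measure_Un_le[OF U[of R'] preimage_sets[OF E(1), of R']]
    by (simp add: U_def R' lessThan_Suc Un_commute)
  moreover have "prob E \<le> \<eta>"
  proof -
    have "prob E * 1 \<le> prob E * (real L + 1)"
      by (intro mult_left_mono) auto
    with bound show ?thesis by simp
  qed
  ultimately have upper: "prob (U R) \<le> d + \<eta>"
    using E by simp
  have inv: "prob (preimage n (U R) \<inter> U R) \<ge> prob (U R) - \<eta>" if "n \<le> L" for n
  proof -
    have "preimage n (U R) - U R \<subseteq> (\<Union>i<n. preimage (R + i) E)"
    proof
      fix x assume x: "x \<in> preimage n (U R) - U R"
      then obtain j where j: "j < R" "x \<in> preimage n (preimage j E)"
        by (auto simp: U_def preimage_def)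
      then have "x \<in> preimage (j + n) E"
        by (simp add: preimage_preimage)
      moreover from this x have "\<not> j + n < R"
        by (auto simp: U_def)
      ultimately show "x \<in> (\<Union>i<n. preimage (R + i) E)"
        using j(1) by (intro UN_I[of "j + n - R"]) auto
    qed
    then have "prob (preimage n (U R) - U R) \<le> prob (\<Union>i<n. preimage (R + i) E)"
      using E by (intro finite_measure_mono) auto
    also have "\<dots> \<le> (\<Sum>i<n. prob (preimage (R + i) E))"
      using E by (intro finite_measure_subadditive_finite) auto
    also have "\<dots> = real n * prob E"
      using E by simp
    also have "\<dots> \<le> prob E * (real L + 1)"
      using that mult_left_mono[of "real n" "real L + 1" "prob E"] by (simp add: mult.commute)
    finally have "prob (preimage n (U R) - U R) \<le> \<eta>"
      using bound by simp
    moreover have "prob (preimage n (U R) - U R) = prob (preimage n (U R)) - prob (preimage n (U R) \<inter> U R)"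
      using U by (intro finite_measure_Diff') auto
    ultimately show ?thesis
      using U by simp
  qed
  show thesis
    using that[of "U R"] U R upper inv by blast
qed

section \<open>Building the over-recurrent set\<close>

text \<open>One step of the construction. A small almost invariant set \<open>D\<close> is first replaced by
  a preimage \<open>C\<close> of itself that is nearly independent of \<open>A\<close>, so that little of \<open>C\<close> is
  wasted inside \<open>A\<close>, and is then added to \<open>A\<close>. The second alternative is the range of times beyond
  the almost invariance of \<open>C\<close>. It starts after the given \<open>K\<close>, so that a fixed time
  escapes it once \<open>K\<close> is large, and where the excess of \<open>A\<close> has already settled near
  \<open>0\<close>.\<close>

lemma enlarge:
  assumes small: "\<And>\<epsilon>. \<epsilon> > 0 \<Longrightarrow> \<exists>E\<in>events. 0 < prob E \<and> prob E < \<epsilon>"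
    and A: "A \<in> events" and d: "0 < d" "prob A + 2 * d < 1 / 16"
  obtains A' where "A' \<in> events" "A \<subseteq> A'" "prob A' \<le> prob A + 2 * d"
    "\<And>n. excess A' n \<ge> excess A n + d / 2 \<or>
       n > K \<and> excess A n \<ge> - d / 8 \<and> excess A' n \<ge> excess A n - d / 4"
proof -
  have "eventually (\<lambda>n. - d / 8 < excess A n) sequentially"
    using order_tendstoD(1)[OF excess_tendsto_0[OF A], of "- d / 8"] d by simp
  then obtain N where N: "\<And>n. n \<ge> N \<Longrightarrow> - d / 8 < excess A n"
    by (auto simp: eventually_sequentially)
  define L where "L = max K N"
  have A0: "0 \<le> prob A"
    by simp
  obtain D where D: "D \<in> events" "d \<le> prob D" "prob D \<le> d + d / 8"
    "\<And>n. n \<le> L \<Longrightarrow> prob (preimage n D \<inter> D) \<ge> prob D - d / 8"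
  proof -
    have "d < 1" "d / 8 > 0"
      using d A0 by linarith+
    from almost_invariant_set[OF small d(1) this, of L] that show thesis
      by blast
  qed
  have "prob D * prob A < d / 8"
  proof -
    have "prob D * prob A \<le> (d + d / 8) * (1 / 16)"
      using D d A0 by (intro mult_mono) auto
    also have "\<dots> < d / 8"
      using d by simp
    finally show ?thesis .
  qed
  then have "eventually (\<lambda>m. prob (preimage m D \<inter> A) < d / 8) sequentially"
    by (rule order_tendstoD(2)[OF preimage_mixing[OF D(1) A]])
  then obtain m where m: "prob (preimage m D \<inter> A) < d / 8"
    by (auto simp: eventually_sequentially)
  define C where "C = preimage m D"
  have C: "C \<in> events" "prob C = prob D" "prob (C \<inter> A) < d / 8"
    using D m by (auto simp: C_def)
  have C_inv: "prob (preimage n C \<inter> C) \<ge> d - d / 8" if "n \<le> L" for n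
  proof -
    have "preimage n C \<inter> C = preimage m (preimage n D \<inter> D)"
      by (simp add: C_def preimage_Int preimage_preimage add.commute)
    then have "prob (preimage n C \<inter> C) = prob (preimage n D \<inter> D)"
      using D by (simp add: sets.Int)
    then show ?thesis
      using D(2) D(4)[OF that] by simp
  qed
  have AC: "prob (A \<union> C) \<le> prob A + 2 * d"
    using measure_Un_le[OF A C(1)] C D d by simp
  have loss: "(prob (A \<union> C))\<^sup>2 \<le> (prob A)\<^sup>2 + d / 4"
  proof -
    have "(prob (A \<union> C))\<^sup>2 \<le> (prob A + 2 * d)\<^sup>2"
      using AC by (intro power_mono) auto
    also have "\<dots> = (prob A)\<^sup>2 + 4 * d * (prob A + d)"
      by (simp add: power2_eq_square algebra_simps)
    also have "4 * d * (prob A + d) \<le> 4 * d * (1 / 16)"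
      using d by (intro mult_left_mono) auto
    finally show ?thesis
      by simp
  qed
  have always: "excess (A \<union> C) n \<ge> excess A n - d / 4" for n
  proof -
    have "prob (preimage n A \<inter> A) \<le> prob (preimage n (A \<union> C) \<inter> (A \<union> C))"
      using A C by (intro finite_measure_mono) (auto simp: preimage_def)
    with loss show ?thesis
      by (simp add: excess_def)
  qed
  \<comment> \<open>Of the measure \<open>d\<close>, the failing invariance of \<open>C\<close> and its overlap with \<open>A\<close> cost \<open>d / 8\<close>
      each, the growth of the square \<open>d / 4\<close>.\<close>
  have gain: "excess (A \<union> C) n \<ge> excess A n + d / 2" if "n \<le> L" for n
  proof -
    let ?P = "preimage n A \<inter> A" and ?Q = "preimage n C \<inter> C"
    have "prob (?P \<union> (?Q - C \<inter> A)) = prob ?P + prob (?Q - C \<inter> A)"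
      using A C by (intro finite_measure_Union) auto
    moreover have "prob (?P \<union> (?Q - C \<inter> A)) \<le> prob (preimage n (A \<union> C) \<inter> (A \<union> C))"
      using A C by (intro finite_measure_mono) (auto simp: preimage_def)
    moreover have "prob (?Q - C \<inter> A) \<ge> prob ?Q - prob (C \<inter> A)"
    proof -
      have "prob ?Q \<le> prob ((?Q - C \<inter> A) \<union> (C \<inter> A))"
        using A C by (intro finite_measure_mono) auto
      also have "\<dots> \<le> prob (?Q - C \<inter> A) + prob (C \<inter> A)"
        using A C by (intro measure_Un_le) auto
      finally show ?thesis by simp
    qed
    ultimately show ?thesis
      using C_inv[OF that] C(3) loss by (simp add: excess_def)
  qed
  show thesis
  proof (rule that[of "A \<union> C"])
    fix n
    show "excess (A \<union> C) n \<ge> excess A n + d / 2 \<or>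
        n > K \<and> excess A n \<ge> - d / 8 \<and> excess (A \<union> C) n \<ge> excess A n - d / 4"
    proof (cases "n \<le> L")
      case False
      then have "K < n" "N \<le> n"
        by (auto simp: L_def)
      then show ?thesis
        using N[of n] always[of n] by simp
    qed (use gain in auto)
  qed (use A C AC in auto)
qed

text \<open>The step from \<open>F k\<close> to \<open>F (Suc k)\<close> adds a set of measure about \<open>d (Suc k)\<close>, where
  \<open>d k = c / 2 ^ k\<close>, and takes \<open>K = k\<close>. Because
  \<open>d k = 2 * d (Suc k)\<close>, the bound \<open>- (3 / 8) * d k\<close> on the excess survives both alternatives,
  and from step \<open>n\<close> on the quantity \<open>excess (F k) n + d k / 2\<close>, the excess together with all the
  gains that are still to come, can only grow.\<close>

theorem over_recurrent_set:
  assumes small: "\<And>\<epsilon>. \<epsilon> > 0 \<Longrightarrow> \<exists>E\<in>events. 0 < prob E \<and> prob E < \<epsilon>"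
    and \<delta>: "\<delta> > 0"
  obtains A where "A \<in> events" "0 < prob A" "prob A < 1" "prob A < \<delta>"
    "\<And>n. prob (preimage n A \<inter> A) > (prob A)\<^sup>2"
proof -
  \<comment> \<open>All sets \<open>F k\<close> will have measure at most \<open>2 * c\<close>, below both \<open>\<delta>\<close> and the bound \<open>1 / 16\<close> of
      \<open>enlarge\<close>.\<close>
  define c where "c = min (1 / 64) (\<delta> / 4)"
  have c: "0 < c" "c \<le> 1 / 64" "c \<le> \<delta> / 4"
    using \<delta> by (auto simp: c_def)
  define d where "d k = c / 2 ^ k" for k :: nat
  have d_pos: "d k > 0" and d_Suc: "d k = 2 * d (Suc k)" for k
    using c by (auto simp: d_def)
  define P where "P k A \<longleftrightarrow> A \<in> events \<and> prob A \<le> 2 * c - 2 * d k" for k A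
  define Q where "Q k A A' \<longleftrightarrow> A \<subseteq> A' \<and>
     (\<forall>n. excess A' n \<ge> excess A n + d (Suc k) / 2 \<or>
       n > k \<and> excess A n \<ge> - d (Suc k) / 8 \<and> excess A' n \<ge> excess A n - d (Suc k) / 4)"
    for k A A'
  have extend: "\<exists>A'. P (Suc k) A' \<and> Q k A A'" if "P k A" for k A
  proof -
    have A: "A \<in> events" "prob A \<le> 2 * c - 4 * d (Suc k)"
      using that d_Suc[of k] by (auto simp: P_def)
    then have "prob A + 2 * d (Suc k) < 1 / 16"
      using c d_pos[of "Suc k"] by linarith
    then obtain A' where A': "A' \<in> events" "A \<subseteq> A'" "prob A' \<le> prob A + 2 * d (Suc k)"
      "\<And>n. excess A' n \<ge> excess A n + d (Suc k) / 2 \<or>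
       n > k \<and> excess A n \<ge> - d (Suc k) / 8 \<and> excess A' n \<ge> excess A n - d (Suc k) / 4"
      using enlarge[OF small A(1) d_pos[of "Suc k"], where K = k] by metis
    have "P (Suc k) A'"
      using A A' by (simp add: P_def)
    moreover have "Q k A A'"
      using A' by (simp add: Q_def)
    ultimately show ?thesis
      by blast
  qed
  \<comment> \<open>Since \<open>d 0 = c\<close>, the condition \<open>P 0\<close> forces the initial set to be null.\<close>
  have "P 0 {}"
    by (simp add: P_def d_def)
  then have "\<exists>F. \<forall>k. P k (F k) \<and> Q k (F k) (F (Suc k))"
    by (intro dependent_nat_choice[of P Q] extend) auto
  then obtain F where FP: "\<And>k. P k (F k)" and FQ: "\<And>k. Q k (F k) (F (Suc k))"
    by blast
  have F: "F k \<in> events" "prob (F k) \<le> 2 * c" for k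
    using FP[of k] d_pos[of k] by (auto simp: P_def)
  have alternative: "excess (F (Suc k)) n \<ge> excess (F k) n + d (Suc k) / 2 \<or>
       n > k \<and> excess (F k) n \<ge> - d (Suc k) / 8 \<and>
       excess (F (Suc k)) n \<ge> excess (F k) n - d (Suc k) / 4" for k n
    using FQ[of k] by (simp add: Q_def)
  have lower: "excess (F k) n \<ge> - (3 / 8) * d k" for k n
  proof (induction k)
    case 0
    have "prob (F 0) = 0"
      using FP[of 0] by (simp add: P_def d_def measure_le_0_iff)
    then have "excess (F 0) n \<ge> 0"
      by (simp add: excess_def)
    then show ?case
      using d_pos[of 0] by linarith
  next
    case (Suc k)
    then show ?case
      using alternative[of k n] d_Suc[of k] d_pos[of "Suc k"] by auto
  qed
  have late: "excess (F k) n + d k / 2 \<ge> d n / 8" if "n \<le> k" for k n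
    using that
  proof (induction k rule: dec_induct)
    case base
    then show ?case
      using lower[of n n] by simp
  next
    case (step k)
    then show ?case
      using alternative[of k n] d_Suc[of k] by auto
  qed
  define A where "A = (\<Union>k. F k)"
  have A: "A \<in> events"
    using F by (auto simp: A_def)
  have inc: "incseq F"
    using FQ by (auto simp: incseq_Suc_iff Q_def)
  have lim: "(\<lambda>k. prob (F k)) \<longlonglongrightarrow> prob A"
    unfolding A_def using F inc by (intro finite_Lim_measure_incseq) auto
  have lim_return: "(\<lambda>k. prob (preimage n (F k) \<inter> F k)) \<longlonglongrightarrow> prob (preimage n A \<inter> A)" for n
  proof -
    have "(\<lambda>k. prob (preimage n (F k) \<inter> F k)) \<longlonglongrightarrow> prob (\<Union>k. preimage n (F k) \<inter> F k)"
    proof (rule finite_Lim_measure_incseq)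
      show "incseq (\<lambda>k. preimage n (F k) \<inter> F k)"
        using inc by (intro monoI Int_mono preimage_mono) (auto dest: incseqD)
    qed (use F in auto)
    moreover have "(\<Union>k. preimage n (F k) \<inter> F k) = preimage n A \<inter> A"
    proof
      show "preimage n A \<inter> A \<subseteq> (\<Union>k. preimage n (F k) \<inter> F k)"
      proof
        fix x assume "x \<in> preimage n A \<inter> A"
        then obtain i j where "x \<in> preimage n (F i)" "x \<in> F j"
          by (auto simp: A_def preimage_def)
        then have "x \<in> preimage n (F (max i j)) \<inter> F (max i j)"
          using preimage_mono incseqD[OF inc, of i "max i j"] incseqD[OF inc, of j "max i j"]
          by (meson IntI max.cobounded1 max.cobounded2 subsetD)
        then show "x \<in> (\<Union>k. preimage n (F k) \<inter> F k)"
          by blast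
      qed
    qed (auto simp: A_def preimage_def)
    ultimately show ?thesis
      by simp
  qed
  have "d \<longlonglongrightarrow> c * 0"
    unfolding d_def divide_inverse power_inverse[symmetric]
    by (intro tendsto_mult tendsto_const LIMSEQ_power_zero) simp
  then have lim_d: "d \<longlonglongrightarrow> 0"
    by simp
  have strict: "prob (preimage n A \<inter> A) > (prob A)\<^sup>2" for n
  proof -
    have "(\<lambda>k. excess (F k) n + d k / 2) \<longlonglongrightarrow> (prob (preimage n A \<inter> A) - (prob A)\<^sup>2) + 0 / 2"
      unfolding excess_def by (intro tendsto_intros lim lim_return lim_d) simp
    then have "d n / 8 \<le> (prob (preimage n A \<inter> A) - (prob A)\<^sup>2) + 0 / 2"
      by (rule LIMSEQ_le_const) (use late in blast)
    then show ?thesis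
      using d_pos[of n] by simp
  qed
  have "prob A \<noteq> 0"
  proof
    assume "prob A = 0"
    then have "prob (preimage 0 A \<inter> A) \<le> 0"
      using A finite_measure_mono[of "preimage 0 A \<inter> A" A] by auto
    with strict[of 0] show False
      by (simp add: \<open>prob A = 0\<close>)
  qed
  moreover have "prob A \<le> 2 * c"
    using lim by (rule LIMSEQ_le_const2) (use F in blast)
  ultimately show thesis
    using that[of A] A strict c \<delta> zero_less_measure_iff[of M A] by force
qed

end

section \<open>Small sets in a Lebesgue space\<close>

text \<open>The interval \<open>[0, t]\<close> is pulled back through the isomorphism, which yields a set that is
  measurable for the completion; its main part is measurable for the original measure.\<close>

lemma lebesgue_space_small_sets:
  assumes "lebesgue_probability_space M" "\<epsilon> > 0"
  shows "\<exists>E\<in>sets M. 0 < measure M E \<and> measure M E < \<epsilon>"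
proof -
  obtain X Y f where iso: "mod_null_isomorphism (completion M) X (lebesgue_on {0..1::real}) Y f"
    using assms unfolding lebesgue_probability_space_def by blast
  let ?N = "lebesgue_on {0..1::real}"
  have X: "X \<in> sets (completion M)" and Y: "Y \<in> sets ?N" "emeasure ?N (space ?N - Y) = 0"
    and bij: "bij_betw f X Y"
    and meas: "f \<in> measurable (restrict_space (completion M) X) (restrict_space ?N Y)"
    and pres: "\<And>A. \<lbrakk>A \<in> sets (completion M); A \<subseteq> X\<rbrakk> \<Longrightarrow> emeasure ?N (f ` A) = emeasure (completion M) A"
    using iso by (auto simp: mod_null_isomorphism_def full_measure_set_def)
  define t where "t = min 1 (\<epsilon> / 2)"
  have t: "0 < t" "t \<le> 1" "t < \<epsilon>"
    using assms by (auto simp: t_def min_def)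
  define B where "B = Y \<inter> {0..t}"
  have I: "{0..t} \<in> sets ?N" "emeasure ?N {0..t} = ennreal t"
    using t by (auto simp: sets_restrict_space_iff emeasure_restrict_space)
  have "B \<in> sets (restrict_space ?N Y)"
    using I Y by (auto simp: B_def sets_restrict_space)
  then have "f -` B \<inter> space (restrict_space (completion M) X) \<in> sets (restrict_space (completion M) X)"
    using meas by (rule measurable_sets[rotated])
  moreover have sp: "space (restrict_space (completion M) X) = X"
    using sets.sets_into_space[OF X] by (auto simp: space_restrict_space)
  ultimately have C: "f -` B \<inter> X \<in> sets (completion M)"
    using X by (auto simp: sets_restrict_space)
  have "f ` (f -` B \<inter> X) = B"
    using bij by (auto simp: bij_betw_def B_def)
  then have "emeasure (completion M) (f -` B \<inter> X) = emeasure ?N B"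
    using pres[OF C] by simp
  also have "emeasure ?N B = emeasure ?N {0..t}"
  proof (rule emeasure_eq_AE)
    have "space ?N - Y \<in> null_sets ?N"
      using Y by auto
    then show "AE x in ?N. x \<in> B \<longleftrightarrow> x \<in> {0..t}"
      by (rule AE_I') (use I Y sets.sets_into_space in \<open>auto simp: B_def\<close>)
  qed (use I Y in \<open>auto simp: B_def\<close>)
  finally have E: "emeasure M (main_part M (f -` B \<inter> X)) = ennreal t"
    using C I by (simp add: emeasure_completion)
  then have "measure M (main_part M (f -` B \<inter> X)) = t"
    using t by (simp add: measure_def)
  then show ?thesis
    using t main_part_sets[OF C] by auto
qed

section \<open>The inverse of an invertible measure preserving map\<close>

context
  fixes M :: "'a measure" and X :: "'a set" and T :: "'a \<Rightarrow> 'a"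
  assumes prob: "prob_space M" and inv: "invertible_measure_preserving M X T"
begin

interpretation prob_space M
  by (rule prob)

text \<open>Off \<open>X\<close>, where \<open>T\<close> need not be invertible, the identity makes the map measurable on
  the whole space without affecting anything but a null set.\<close>

definition inverse_map :: "'a \<Rightarrow> 'a" where
  "inverse_map x = (if x \<in> X then inv_into X T x else x)"

lemma X_sets: "X \<in> sets M"
  and X_null: "space M - X \<in> null_sets M"
  and bij: "bij_betw T X X"
  and T_measurable: "T \<in> measurable (restrict_space M X) (restrict_space M X)"
  and inv_measurable: "inv_into X T \<in> measurable (restrict_space M X) (restrict_space M X)"
  and image_preserving: "\<lbrakk>A \<in> sets M; A \<subseteq> X\<rbrakk> \<Longrightarrow> emeasure M (T ` A) = emeasure M A"
  using inv by (auto simp: invertible_measure_preserving_def mod_null_isomorphism_def full_measure_set_def)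

lemma T_in: "x \<in> X \<Longrightarrow> T x \<in> X"
  using bij by (auto simp: bij_betw_def)

lemma inverse_map_in: "x \<in> X \<Longrightarrow> inverse_map x \<in> X"
  using bij_betw_inv_into[OF bij] by (auto simp: inverse_map_def bij_betw_def)

lemma T_pow_in: "x \<in> X \<Longrightarrow> (T ^^ n) x \<in> X"
  by (induction n) (auto intro: T_in)

lemma inverse_map_pow_in: "x \<in> X \<Longrightarrow> (inverse_map ^^ n) x \<in> X"
  by (induction n) (auto intro: inverse_map_in)

lemma inverse_map_T: "x \<in> X \<Longrightarrow> inverse_map (T x) = x"
  using T_in bij by (simp add: inverse_map_def bij_betw_inv_into_left)

lemma T_inverse_map: "x \<in> X \<Longrightarrow> T (inverse_map x) = x"
  using bij by (simp add: inverse_map_def bij_betw_inv_into_right)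

lemma inverse_map_pow_T_pow: "x \<in> X \<Longrightarrow> (inverse_map ^^ n) ((T ^^ n) x) = x"
  by (induction n arbitrary: x) (simp_all add: funpow_Suc_right inverse_map_T T_pow_in T_in
      flip: funpow.simps(2) funpow_swap1)

lemma T_pow_inverse_map_pow: "x \<in> X \<Longrightarrow> (T ^^ n) ((inverse_map ^^ n) x) = x"
proof (induction n)
  case (Suc n)
  have "(T ^^ Suc n) ((inverse_map ^^ Suc n) x) = (T ^^ n) (T (inverse_map ((inverse_map ^^ n) x)))"
    by (simp only: funpow_Suc_right[of n T] funpow.simps(2)[of n inverse_map] o_apply)
  with Suc show ?case
    by (simp add: T_inverse_map inverse_map_pow_in)
qed simp

lemma inv_into_pow: "x \<in> X \<Longrightarrow> (inv_into X T ^^ n) x = (inverse_map ^^ n) x"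
  by (induction n) (auto simp: inverse_map_def[of "(inverse_map ^^ _) x"] inverse_map_pow_in)

lemma iterate_image_nonneg:
  "iterate_image X T (int n) A = (inverse_map ^^ n) -` A \<inter> X"
proof -
  have "y \<in> (T ^^ n) ` (A \<inter> X)" if "y \<in> X" "(inverse_map ^^ n) y \<in> A" for y
    using that T_pow_inverse_map_pow[of y n] inverse_map_pow_in[of y n]
    by (metis IntI imageI)
  then show ?thesis
    by (auto simp: iterate_image_def int_iterate_def inverse_map_pow_T_pow T_pow_in)
qed

lemma iterate_image_neg:
  "iterate_image X T (- int n) A = (inverse_map ^^ n) ` (A \<inter> X)"
  by (cases "n = 0") (auto simp: iterate_image_def int_iterate_def inv_into_pow intro!: image_cong)

lemma T_image: "T ` (B \<inter> X) = inverse_map -` B \<inter> X"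
  using iterate_image_nonneg[of 1 B] by (simp add: iterate_image_def int_iterate_def)

lemma inverse_map_vimage:
  assumes "B \<in> sets M"
  shows "inverse_map -` B \<inter> space M = T ` (B \<inter> X) \<union> (B - X)"
  using sets.sets_into_space[OF assms] sets.sets_into_space[OF X_sets]
  unfolding T_image by (auto simp: inverse_map_def split: if_splits)

lemma space_restrict_X: "space (restrict_space M X) = X"
  using sets.sets_into_space[OF X_sets] by (auto simp: space_restrict_space)

lemma restrict_X_sets: "B \<in> sets (restrict_space M X) \<longleftrightarrow> B \<in> sets M \<and> B \<subseteq> X"
  using X_sets sets.sets_into_space[OF X_sets] by (subst sets_restrict_space_iff) auto

lemma image_sets:
  assumes "B \<in> sets M"
  shows "T ` (B \<inter> X) \<in> sets M"
proof -
  have "B \<inter> X \<in> sets (restrict_space M X)"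
    using assms X_sets by (simp add: restrict_X_sets)
  from measurable_sets[OF inv_measurable this]
  have "inv_into X T -` (B \<inter> X) \<inter> X \<in> sets M"
    by (simp add: space_restrict_X restrict_X_sets)
  moreover have "inv_into X T -` (B \<inter> X) \<inter> X = T ` (B \<inter> X)"
    unfolding T_image using inverse_map_in by (auto simp: inverse_map_def)
  ultimately show ?thesis
    by simp
qed

lemma inverse_map_measurable: "inverse_map \<in> measurable M M"
proof (rule measurableI)
  show "inverse_map x \<in> space M" if "x \<in> space M" for x
    using that inverse_map_in sets.sets_into_space[OF X_sets]
    by (cases "x \<in> X") (auto simp: inverse_map_def)
  show "inverse_map -` B \<inter> space M \<in> sets M" if "B \<in> sets M" for B
    using that image_sets X_sets by (auto simp: inverse_map_vimage)
qed

lemma measure_vimage_eq_iterate_image: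
  assumes "A \<in> sets M" "B \<in> sets M"
  shows "measure M ((inverse_map ^^ n) -` A \<inter> space M \<inter> B) =
    measure M (iterate_image X T (int n) A \<inter> B)"
proof -
  have V: "(inverse_map ^^ n) -` A \<inter> space M \<in> sets M"
    using measurable_sets[OF measurable_funpow[OF inverse_map_measurable] assms(1)] .
  have eq: "iterate_image X T (int n) A = (inverse_map ^^ n) -` A \<inter> space M \<inter> X"
    using sets.sets_into_space[OF X_sets] by (auto simp: iterate_image_nonneg)
  have "AE x in M. x \<in> X"
    using X_null by (rule AE_I') auto
  then show ?thesis
    unfolding eq using V assms X_sets by (intro measure_eq_AE) auto
qed

lemma mixing_endomorphism_inverse_map:
  assumes "strong_mixing M X T"
  shows "mixing_endomorphism M inverse_map"
proof
  have null: "N \<in> null_sets M" if "N \<in> sets M" "N \<inter> X = {}" for N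
    using that sets.sets_into_space[OF that(1)] X_null by (meson null_sets_subset Diff_iff disjoint_iff subset_iff)
  show "inverse_map \<in> measurable M M"
    by (rule inverse_map_measurable)
  show "measure M (inverse_map -` B \<inter> space M) = measure M B" if "B \<in> sets M" for B
  proof -
    have "measure M (T ` (B \<inter> X) \<union> (B - X)) = measure M (T ` (B \<inter> X))"
      using that X_sets image_sets[OF that] by (intro measure_Un_null_set null) auto
    also have "\<dots> = measure M (B \<inter> X)"
      using that X_sets image_preserving[of "B \<inter> X"] by (simp add: measure_def)
    also have "\<dots> = measure M ((B \<inter> X) \<union> (B - X))"
      using that X_sets by (intro measure_Un_null_set[symmetric] null) auto
    finally show ?thesis
      by (simp add: inverse_map_vimage that Int_Diff_Un)
  qed
  show "(\<lambda>n. measure M ((inverse_map ^^ n) -` A \<inter> space M \<inter> B)) \<longlonglongrightarrow> measure M A * measure M B"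
    if "A \<in> sets M" "B \<in> sets M" for A B
    using assms that by (simp add: measure_vimage_eq_iterate_image strong_mixing_def)
qed

lemma measure_T_pow_image:
  assumes "A \<in> sets M" "A \<subseteq> X"
  shows "measure M ((T ^^ n) ` A) = measure M A"
proof -
  have "(T ^^ n) ` A \<in> sets M \<and> (T ^^ n) ` A \<subseteq> X \<and> emeasure M ((T ^^ n) ` A) = emeasure M A"
  proof (induction n)
    case (Suc n)
    have "(T ^^ Suc n) ` A = T ` ((T ^^ n) ` A)"
      by (simp add: image_comp)
    with Suc show ?case
      using image_sets[of "(T ^^ n) ` A"] image_preserving[of "(T ^^ n) ` A"] T_in
      by (auto simp: Int_absorb2)
  qed (use assms in auto)
  then show ?thesis
    by (simp add: measure_def)
qed

text \<open>Applying \<open>T\<^sup>n\<close> to \<open>T\<^sup>-\<^sup>n A \<inter> A\<close> gives \<open>A \<inter> T\<^sup>n A\<close>, and powers of \<open>T\<close>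
  preserve the measure.\<close>

lemma measure_iterate_image_uminus:
  assumes "A \<in> sets M"
  shows "measure M (iterate_image X T (- int n) A \<inter> A) = measure M (iterate_image X T (int n) A \<inter> A)"
proof -
  let ?C = "iterate_image X T (- int n) A \<inter> A"
  have C: "?C \<subseteq> X"
    using inverse_map_pow_in by (auto simp: iterate_image_neg)
  have image: "(T ^^ n) ` ?C = iterate_image X T (int n) A \<inter> A"
  proof
    show "(T ^^ n) ` ?C \<subseteq> iterate_image X T (int n) A \<inter> A"
      by (auto simp: iterate_image_neg iterate_image_nonneg T_pow_inverse_map_pow)
    show "iterate_image X T (int n) A \<inter> A \<subseteq> (T ^^ n) ` ?C"
    proof
      fix y assume "y \<in> iterate_image X T (int n) A \<inter> A"
      then show "y \<in> (T ^^ n) ` ?C"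
        by (intro image_eqI[of _ _ "(inverse_map ^^ n) y"])
          (auto simp: iterate_image_neg iterate_image_nonneg T_pow_inverse_map_pow)
    qed
  qed
  have "A \<inter> X \<in> sets (restrict_space M X)"
    using assms X_sets by (simp add: restrict_X_sets)
  from measurable_sets[OF measurable_funpow[OF T_measurable] this, of n]
  have "(T ^^ n) -` (A \<inter> X) \<inter> X \<in> sets M"
    by (simp add: space_restrict_X restrict_X_sets)
  moreover have "iterate_image X T (- int n) A = (T ^^ n) -` (A \<inter> X) \<inter> X"
    unfolding iterate_image_neg
    by (auto simp: T_pow_inverse_map_pow inverse_map_pow_in image_iff
        intro!: bexI[of _ "(T ^^ n) _"] inverse_map_pow_T_pow[symmetric])
  ultimately have "?C \<in> sets M"
    using assms by simp
  then show ?thesis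
    using measure_T_pow_image[of ?C n] C image by simp
qed

end

section \<open>Strictly over-recurrent sets\<close>

theorem theorem3p1:
  fixes M :: "'a measure" and X :: "'a set" and T :: "'a \<Rightarrow> 'a" and \<delta> :: real
  assumes "lebesgue_probability_space M"
    and "invertible_measure_preserving M X T"
    and "strong_mixing M X T"
    and "\<delta> > 0"
  shows "\<exists>A. strictly_over_recurrent M X T A \<and> measure M A < \<delta>"
proof -
  have prob: "prob_space M"
    using assms by (simp add: lebesgue_probability_space_def)
  interpret mixing_endomorphism M "inverse_map X T"
    using prob assms by (intro mixing_endomorphism_inverse_map)
  obtain A where A: "A \<in> events" "0 < prob A" "prob A < 1" "prob A < \<delta>"
    "\<And>n. prob (preimage n A \<inter> A) > (prob A)\<^sup>2"
    using over_recurrent_set[OF lebesgue_space_small_sets[OF assms(1)] assms(4)] by blast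
  have nonneg: "prob (iterate_image X T (int n) A \<inter> A) > (prob A)\<^sup>2" for n
    using A(5)[of n] measure_vimage_eq_iterate_image[OF prob assms(2) A(1) A(1)]
    by (simp add: preimage_def)
  have "prob (iterate_image X T n A \<inter> A) > (prob A)\<^sup>2" for n :: int
    by (cases n rule: int_cases2)
      (simp_all only: nonneg measure_iterate_image_uminus[OF prob assms(2) A(1)])
  then show ?thesis
    using A by (auto simp: strictly_over_recurrent_def)
qed

end
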